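(* As formal power series in $z$, \[ \sum_{n\ge0}\sum_{\pi\in\mathcal S_n}p^{\mathrm{des}(\pi)}q^{\mathrm{asc}(\pi)}x^{\mathrm{cyc}(\pi)}z^{n} =\cfrac{1}{1-xz-\cfrac{qxz^{2}}{1-(q+p+x)z-\cfrac{2q(p+x)z^{2}}{1-(2q+2p+x)z-\cfrac{3q(2p+x)z^{2}}{1-(3q+3p+x)z-\cdots}}}}, \] i.e. the continued fraction whose $h$-th level ($h\ge0$) has denominator $1-(hq+hp+x)z$ and whose $h$-th partial numerator is $(h+1)q(hp+x)z^2$.
   Context: $\mathcal S_n$ is the set of permutations of $[n]=\{1,\dots,n\}$; $\mathcal S_0$ consists of the empty permutation (0 cycles, 0 ascents, 0 descents). The standard cycle form of $\pi$ writes each cycle starting with its smallest element and lists cycles in decreasing order of their smallest elements. $\Psi(\pi)$ is the word obtained by deleting the parentheses from the standard cycle form. $\mathrm{cyc}(\pi)$ is the number of cycles. A cyclic ascent (resp. descent) of $\pi$ is a position $i$ such that $\Psi(\pi)_i$ and $\Psi(\pi)_{i+1}$ lie in the same cycle and $\Psi(\pi)_i<\Psi(\pi)_{i+1}$ (resp. $>$); $\mathrm{asc}(\pi)$ and $\mathrm{des}(\pi)$ count them. *)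

theory Defs
  imports
    "HOL-Combinatorics.Combinatorics"
    "HOL-Computational_Algebra.Formal_Power_Series"
begin

text \<open>
  A permutation of \<open>[n]\<close> is a function \<open>\<pi> :: nat \<Rightarrow> nat\<close> with \<open>\<pi> permutes {1..n}\<close>. Since \<open>\<pi>\<close> fixes
  every number outside \<open>[n]\<close>, the statistics take \<open>n\<close> as an argument.
\<close>

definition cycle_minima :: "nat \<Rightarrow> (nat \<Rightarrow> nat) \<Rightarrow> nat set"
  where "cycle_minima n \<pi> = {m \<in> {1..n}. \<forall>j \<in> orbit \<pi> m. m \<le> j}"

text \<open>\<open>support \<pi> m\<close> is the list \<open>[m, \<pi> m, \<pi> (\<pi> m), \<dots>]\<close>, running once through the cycle of \<open>m\<close>.\<close>

definition standard_cycle_form :: "nat \<Rightarrow> (nat \<Rightarrow> nat) \<Rightarrow> nat list list"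
  where "standard_cycle_form n \<pi> =
    map (support \<pi>) (rev (sorted_list_of_set (cycle_minima n \<pi>)))"

definition Psi :: "nat \<Rightarrow> (nat \<Rightarrow> nat) \<Rightarrow> nat list"
  where "Psi n \<pi> = concat (standard_cycle_form n \<pi>)"

definition cyc :: "nat \<Rightarrow> (nat \<Rightarrow> nat) \<Rightarrow> nat"
  where "cyc n \<pi> = card (orbit \<pi> ` {1..n})"

text \<open>List positions count from \<open>0\<close>, so position \<open>i\<close> here is position \<open>i + 1\<close> of the word.\<close>

definition cyclic_ascents :: "nat \<Rightarrow> (nat \<Rightarrow> nat) \<Rightarrow> nat set"
  where "cyclic_ascents n \<pi> = {i. i + 1 < length (Psi n \<pi>) \<and>
    Psi n \<pi> ! (i + 1) \<in> orbit \<pi> (Psi n \<pi> ! i) \<and> Psi n \<pi> ! i < Psi n \<pi> ! (i + 1)}"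

definition cyclic_descents :: "nat \<Rightarrow> (nat \<Rightarrow> nat) \<Rightarrow> nat set"
  where "cyclic_descents n \<pi> = {i. i + 1 < length (Psi n \<pi>) \<and>
    Psi n \<pi> ! (i + 1) \<in> orbit \<pi> (Psi n \<pi> ! i) \<and> Psi n \<pi> ! i > Psi n \<pi> ! (i + 1)}"

definition asc :: "nat \<Rightarrow> (nat \<Rightarrow> nat) \<Rightarrow> nat"
  where "asc n \<pi> = card (cyclic_ascents n \<pi>)"

definition des :: "nat \<Rightarrow> (nat \<Rightarrow> nat) \<Rightarrow> nat"
  where "des n \<pi> = card (cyclic_descents n \<pi>)"

text \<open>
  The library's \<open>inverse\<close> on power series needs an \<open>inverse\<close> on the coefficients. Over a
  commutative ring we use the library's ring version, for constant coefficient \<open>1\<close>.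
\<close>

definition fps_recip :: "'a::comm_ring_1 fps \<Rightarrow> 'a fps"
  where "fps_recip f = fps_right_inverse f 1"

lemma mult_fps_recip: "fps_nth f 0 = 1 \<Longrightarrow> f * fps_recip f = 1"
  unfolding fps_recip_def by (rule fps_right_inverse) simp

text \<open>
  \<open>cfrac_tail D A N h\<close> consists of the \<open>N\<close> levels \<open>h, \<dots>, h + N - 1\<close> of the continued fraction,
  \<open>1 / (D h - A h / (D (h + 1) - \<dots> - A (h + N - 2) / D (h + N - 1)))\<close>.
  The infinite continued fraction is the limit of its convergents \<open>cfrac_tail D A N 0\<close>
  in the (formal, \<open>fps_X\<close>-adic) topology of the power series.
\<close>

primrec cfrac_tail ::
    "(nat \<Rightarrow> 'a::comm_ring_1 fps) \<Rightarrow> (nat \<Rightarrow> 'a fps) \<Rightarrow> nat \<Rightarrow> nat \<Rightarrow> 'a fps"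
  where
    "cfrac_tail D A 0 h = 0"
  | "cfrac_tail D A (Suc N) h = fps_recip (D h - A h * cfrac_tail D A N (Suc h))"

definition has_cfrac ::
    "'a::comm_ring_1 fps \<Rightarrow> (nat \<Rightarrow> 'a fps) \<Rightarrow> (nat \<Rightarrow> 'a fps) \<Rightarrow> bool"
  where "has_cfrac F D A \<longleftrightarrow> (\<lambda>N. cfrac_tail D A N 0) \<longlonglongrightarrow> F"

end

theory Submission
  imports Defs
begin

text \<open>
  The ascents of \<open>\<pi>\<close> correspond to the \<open>j\<close> with \<open>j < \<pi> j\<close>, and \<open>des + asc + cyc = n\<close>, because the only
  elements starting neither an ascent nor a descent are those sent to a cycle minimum. Inserting
  \<open>n + 1\<close> after \<open>j\<close> multiplies the weight by \<open>p\<close> if \<open>j < \<pi> j\<close> and by \<open>q\<close> otherwise, and a new fixed point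
  multiplies it by \<open>x\<close>. So the weight sums satisfy \<open>P (n + 1) = (x + E) (P n)\<close> for the derivation
  \<open>E = p q (\<partial>\<^sub>p + \<partial>\<^sub>q) + q x \<partial>\<^sub>x\<close>. The coefficients \<open>b k = k q + k p + x\<close> and \<open>l k = k q ((k - 1) p + x)\<close> of the
  continued fraction satisfy the Toda equations \<open>E (b k) = l (k + 1) - l k\<close> and
  \<open>E (l k) = l k (b k - b (k - 1))\<close>, so the weighted sums \<open>M n k\<close> over Motzkin paths from height
  \<open>0\<close> to height \<open>k\<close> satisfy \<open>E (M n k) = l (k + 1) M n (k + 1)\<close>; at \<open>k = 0\<close> this is the recurrence for \<open>P\<close>.

  By Euler's identity, \<open>E = q m + (p - q) q \<partial>\<^sub>q\<close> on polynomials homogeneous of degree \<open>m\<close>, so only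
  a derivation in the single variable \<open>q\<close> is needed.
\<close>

subsection \<open>Statistics in terms of excedances and cycle minima\<close>

lemma orbit_eq_of_mem:
  assumes "permutation f" "y \<in> orbit f x"
  shows "orbit f y = orbit f x"
  using assms by (meson cyclic_on_orbit' orbit_cyclic_eq3)

lemma set_support:
  assumes "permutation f"
  shows "set (support f m) = orbit f m"
proof -
  have "set (support f m) = range (\<lambda>i. (f ^^ i) m)" using assms by (rule support_set)
  also have "\<dots> = orbit f m" using assms by (auto simp: orbit_altdef_permutation)
  finally show ?thesis .
qed

lemma apply_support_nth:
  assumes "permutation f" "i < length (support f m)"
  shows "f (support f m ! i) = (if Suc i < length (support f m) then support f m ! Suc i else m)"
proof (cases "Suc i < length (support f m)")
  case False
  then have "Suc i = least_power f m" using assms(2) by simp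
  then have "(f ^^ Suc i) m = m" using least_power_of_permutation(1)[OF assms(1)] by metis
  then show ?thesis using False assms(2) by simp
qed (use assms in simp)

text \<open>Inside the word the next letter is the image under \<open>f\<close>, except at the last
  letter of a cycle, whose image is the start of that cycle. As no two starts share an orbit, having
  an image in \<open>set ms\<close> marks exactly these last letters.\<close>

lemma concat_supports:
  assumes "permutation f" "distinct ms"
    and "\<And>m m'. m \<in> set ms \<Longrightarrow> m' \<in> set ms \<Longrightarrow> m' \<in> orbit f m \<Longrightarrow> m' = m"
  defines "w \<equiv> concat (map (support f) ms)"
  shows "set w = (\<Union>m\<in>set ms. orbit f m)" and "distinct w"
    and "\<And>i. i < length w \<Longrightarrow>
      Suc i < length w \<and> w ! Suc i \<in> orbit f (w ! i) \<longleftrightarrow> f (w ! i) \<notin> set ms"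
    and "\<And>i. i < length w \<Longrightarrow> f (w ! i) \<notin> set ms \<Longrightarrow> w ! Suc i = f (w ! i)"
proof -
  note perm = assms(1)
  have "set w = (\<Union>m\<in>set ms. orbit f m) \<and> distinct w \<and> (\<forall>i < length w.
      (Suc i < length w \<and> w ! Suc i \<in> orbit f (w ! i) \<longleftrightarrow> f (w ! i) \<notin> set ms)
      \<and> (f (w ! i) \<notin> set ms \<longrightarrow> w ! Suc i = f (w ! i)))"
    using assms(2,3) unfolding w_def
  proof (induction ms)
    case (Cons m ms)
    define u where "u = support f m"
    define v where "v = concat (map (support f) ms)"
    have w: "concat (map (support f) (m # ms)) = u @ v" by (simp add: u_def v_def)
    have uniq: "a = b"
      if "a \<in> set (m # ms)" "b \<in> set (m # ms)" "a \<in> orbit f b" for a b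
      using Cons.prems that by auto
    have "set v = (\<Union>m\<in>set ms. orbit f m) \<and> distinct v \<and> (\<forall>i < length v.
        (Suc i < length v \<and> v ! Suc i \<in> orbit f (v ! i) \<longleftrightarrow> f (v ! i) \<notin> set ms)
        \<and> (f (v ! i) \<notin> set ms \<longrightarrow> v ! Suc i = f (v ! i)))"
      unfolding v_def by (rule Cons.IH) (use Cons.prems in auto)
    then have IH: "set v = (\<Union>m\<in>set ms. orbit f m)" "distinct v"
      "\<And>i. i < length v \<Longrightarrow> Suc i < length v \<and> v ! Suc i \<in> orbit f (v ! i) \<longleftrightarrow> f (v ! i) \<notin> set ms"
      "\<And>i. i < length v \<Longrightarrow> f (v ! i) \<notin> set ms \<Longrightarrow> v ! Suc i = f (v ! i)"
      by blast+
    have set_u: "set u = orbit f m" unfolding u_def by (rule set_support[OF perm])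
    have dist_u: "distinct u" unfolding u_def by (rule cycle_of_permutation[OF perm])
    have u_0: "u ! 0 = m" "0 < length u"
      using least_power_of_permutation(2)[OF perm, of m] by (simp_all add: u_def)
    have u_succ: "f (u ! i) = (if Suc i < length u then u ! Suc i else m)" if "i < length u" for i
      using apply_support_nth[OF perm] that unfolding u_def by blast
    have disj: "y \<notin> orbit f m" if y: "y \<in> set v" for y
    proof
      assume "y \<in> orbit f m"
      moreover obtain m' where m': "m' \<in> set ms" "y \<in> orbit f m'" using y IH(1) by auto
      ultimately have "orbit f m = orbit f m'" using orbit_eq_of_mem[OF perm] by metis
      then have "m' \<in> orbit f m" using permutation_self_in_orbit[OF perm] by metis
      then have "m' = m" using uniq m'(1) by simp
      then show False using m'(1) Cons.prems(1) by simp
    qed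
    show ?case unfolding w
    proof (intro conjI allI impI)
      show "set (u @ v) = (\<Union>m\<in>set (m # ms). orbit f m)" using set_u IH(1) by simp
      show "distinct (u @ v)" using dist_u IH(2) disj set_u by auto
    next
      fix i assume i: "i < length (u @ v)"
      have "(Suc i < length (u @ v) \<and> (u @ v) ! Suc i \<in> orbit f ((u @ v) ! i)
            \<longleftrightarrow> f ((u @ v) ! i) \<notin> set (m # ms))
          \<and> (f ((u @ v) ! i) \<notin> set (m # ms) \<longrightarrow> (u @ v) ! Suc i = f ((u @ v) ! i))"
      proof -
        \<comment> \<open>The position is inside the first cycle, at its end, or in a later cycle.
          At the end the next letter, if there is one, lies in another orbit.\<close>
        consider "Suc i < length u" | "Suc i = length u" | "length u \<le> i" by linarith
        then show ?thesis
        proof cases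
          case 1
          then have f: "f (u ! i) = u ! Suc i" using u_succ by simp
          then have "u ! Suc i \<in> orbit f (u ! i)" using orbit.base by metis
          moreover have "u ! Suc i \<noteq> m"
            using 1 u_0 dist_u by (metis nth_eq_iff_index_eq nat.distinct(1))
          moreover have "u ! Suc i \<in> orbit f m" using 1 set_u nth_mem by blast
          ultimately show ?thesis using 1 f uniq by (auto simp: nth_append)
        next
          case 2
          then have "f (u ! i) = m" using u_succ by simp
          moreover have "v ! 0 \<notin> orbit f (u ! i)" if "v \<noteq> []"
          proof -
            have "orbit f (u ! i) = orbit f m"
              using 2 set_u nth_mem orbit_eq_of_mem[OF perm] by (metis lessI)
            then show ?thesis using disj that by (metis length_greater_0_conv nth_mem)
          qed
          ultimately show ?thesis using 2 by (auto simp: nth_append)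
        next
          case 3
          define j where "j = i - length u"
          have j: "i = length u + j" "j < length v" using 3 i by (auto simp: j_def)
          obtain m' where m': "m' \<in> set ms" "v ! j \<in> orbit f m'"
            using j(2) IH(1) nth_mem by blast
          \<comment> \<open>The image stays in \<open>v\<close>, which misses the orbit of
            \<open>m\<close>, so testing against \<open>set (m # ms)\<close> amounts to testing
            against \<open>set ms\<close>.\<close>
          then have "f (v ! j) \<in> set v" using IH(1) by (auto intro: orbit.step)
          then have "f (v ! j) \<noteq> m" using disj permutation_self_in_orbit[OF perm] by metis
          then show ?thesis using IH(3,4)[OF j(2)] j(2) by (auto simp: j(1) nth_append)
        qed
      qed
      then show "Suc i < length (u @ v) \<and> (u @ v) ! Suc i \<in> orbit f ((u @ v) ! i)
            \<longleftrightarrow> f ((u @ v) ! i) \<notin> set (m # ms)"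
        and "f ((u @ v) ! i) \<notin> set (m # ms) \<Longrightarrow> (u @ v) ! Suc i = f ((u @ v) ! i)"
        by blast+
    qed
  qed simp
  then show "set w = (\<Union>m\<in>set ms. orbit f m)" and "distinct w"
    and "\<And>i. i < length w \<Longrightarrow>
      Suc i < length w \<and> w ! Suc i \<in> orbit f (w ! i) \<longleftrightarrow> f (w ! i) \<notin> set ms"
    and "\<And>i. i < length w \<Longrightarrow> f (w ! i) \<notin> set ms \<Longrightarrow> w ! Suc i = f (w ! i)"
    by blast+
qed

section \<open>Cycle minima and the word \<open>Psi\<close>\<close>

lemma permutation_of_permutes: "\<pi> permutes {1..n::nat} \<Longrightarrow> permutation \<pi>"
  using permutation_permutes by blast

lemma finite_cycle_minima: "finite (cycle_minima n \<pi>)"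
  by (simp add: cycle_minima_def)

lemma cycle_minima_unique:
  assumes "permutation \<pi>" "m \<in> cycle_minima n \<pi>" "m' \<in> cycle_minima n \<pi>" "m' \<in> orbit \<pi> m"
  shows "m' = m"
proof -
  have "orbit \<pi> m' = orbit \<pi> m" using assms(1,4) orbit_eq_of_mem by metis
  then have "m \<in> orbit \<pi> m'" using permutation_self_in_orbit[OF assms(1)] by simp
  then show ?thesis using assms(2-4) unfolding cycle_minima_def by force
qed

lemma cycle_minimum_exists:
  assumes "\<pi> permutes {1..n}" "j \<in> {1..n}"
  obtains m where "m \<in> cycle_minima n \<pi>" "orbit \<pi> m = orbit \<pi> j"
proof -
  have perm: "permutation \<pi>" using assms(1) by (rule permutation_of_permutes)
  define m where "m = Min (orbit \<pi> j)"
  have fin: "finite (orbit \<pi> j)" using finite_orbit permutation_self_in_orbit[OF perm] by metis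
  then have "m \<in> orbit \<pi> j" unfolding m_def by (rule Min_in) (rule orbit_nonempty)
  then have "orbit \<pi> m = orbit \<pi> j" by (rule orbit_eq_of_mem[OF perm])
  moreover have "m \<in> {1..n}"
    using \<open>m \<in> orbit \<pi> j\<close> permutes_orbit_subset[OF assms] by (rule rev_subsetD)
  ultimately have "m \<in> cycle_minima n \<pi>"
    using fin by (simp add: cycle_minima_def m_def)
  with \<open>orbit \<pi> m = orbit \<pi> j\<close> show ?thesis using that by blast
qed

lemma cyc_eq_card_cycle_minima:
  assumes "\<pi> permutes {1..n}"
  shows "cyc n \<pi> = card (cycle_minima n \<pi>)"
proof -
  have perm: "permutation \<pi>" using assms by (rule permutation_of_permutes)
  have "inj_on (orbit \<pi>) (cycle_minima n \<pi>)"
  proof (rule inj_onI)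
    fix m m' assume "m \<in> cycle_minima n \<pi>" "m' \<in> cycle_minima n \<pi>" "orbit \<pi> m = orbit \<pi> m'"
    then show "m = m'"
      using cycle_minima_unique[OF perm, of m'] permutation_self_in_orbit[OF perm] by blast
  qed
  moreover have "orbit \<pi> ` {1..n} = orbit \<pi> ` cycle_minima n \<pi>"
  proof
    show "orbit \<pi> ` {1..n} \<subseteq> orbit \<pi> ` cycle_minima n \<pi>"
    proof (rule image_subsetI)
      fix j assume "j \<in> {1..n}"
      then show "orbit \<pi> j \<in> orbit \<pi> ` cycle_minima n \<pi>"
        using cycle_minimum_exists[OF assms] by (metis image_eqI)
    qed
  qed (auto simp: cycle_minima_def)
  ultimately show ?thesis by (simp add: cyc_def card_image)
qed

text \<open>\<open>j\<close> lies in the cycle of \<open>\<pi> j\<close>. Hence an element sent to a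
  cycle minimum is never an excedance.\<close>

lemma cycle_minimum_le:
  assumes "permutation \<pi>" "\<pi> j \<in> cycle_minima n \<pi>"
  shows "\<pi> j \<le> j"
proof -
  have "j \<in> orbit \<pi> (\<pi> j)"
    using assms(1) by (simp add: permutation_orbit_step permutation_self_in_orbit)
  then show ?thesis using assms(2) by (simp add: cycle_minima_def)
qed

lemma Psi_facts:
  assumes "\<pi> permutes {1..n}"
  shows "set (Psi n \<pi>) = {1..n}" and "distinct (Psi n \<pi>)"
    and "\<And>i. i < length (Psi n \<pi>) \<Longrightarrow>
      Suc i < length (Psi n \<pi>) \<and> Psi n \<pi> ! Suc i \<in> orbit \<pi> (Psi n \<pi> ! i)
        \<longleftrightarrow> \<pi> (Psi n \<pi> ! i) \<notin> cycle_minima n \<pi>"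
    and "\<And>i. i < length (Psi n \<pi>) \<Longrightarrow> \<pi> (Psi n \<pi> ! i) \<notin> cycle_minima n \<pi> \<Longrightarrow>
      Psi n \<pi> ! Suc i = \<pi> (Psi n \<pi> ! i)"
proof -
  have perm: "permutation \<pi>" using assms by (rule permutation_of_permutes)
  define ms where "ms = rev (sorted_list_of_set (cycle_minima n \<pi>))"
  have ms: "set ms = cycle_minima n \<pi>" "distinct ms"
    by (simp_all add: ms_def finite_cycle_minima)
  have uniq: "m' = m" if "m \<in> set ms" "m' \<in> set ms" "m' \<in> orbit \<pi> m" for m m'
    using that cycle_minima_unique[OF perm] by (simp add: ms)
  have Psi: "Psi n \<pi> = concat (map (support \<pi>) ms)"
    by (simp add: Psi_def standard_cycle_form_def ms_def)
  note facts = concat_supports[OF perm ms(2) uniq]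
  show "distinct (Psi n \<pi>)"
    and "\<And>i. i < length (Psi n \<pi>) \<Longrightarrow>
      Suc i < length (Psi n \<pi>) \<and> Psi n \<pi> ! Suc i \<in> orbit \<pi> (Psi n \<pi> ! i)
        \<longleftrightarrow> \<pi> (Psi n \<pi> ! i) \<notin> cycle_minima n \<pi>"
    and "\<And>i. i < length (Psi n \<pi>) \<Longrightarrow> \<pi> (Psi n \<pi> ! i) \<notin> cycle_minima n \<pi> \<Longrightarrow>
      Psi n \<pi> ! Suc i = \<pi> (Psi n \<pi> ! i)"
    using facts(2-4) unfolding Psi ms(1) by blast+
  have "(\<Union>m\<in>cycle_minima n \<pi>. orbit \<pi> m) = {1..n}"
  proof
    show "(\<Union>m\<in>cycle_minima n \<pi>. orbit \<pi> m) \<subseteq> {1..n}"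
      using permutes_orbit_subset[OF assms] by (auto simp: cycle_minima_def)
    show "{1..n} \<subseteq> (\<Union>m\<in>cycle_minima n \<pi>. orbit \<pi> m)"
    proof
      fix j assume "j \<in> {1..n}"
      with assms obtain m where "m \<in> cycle_minima n \<pi>" "orbit \<pi> m = orbit \<pi> j"
        by (rule cycle_minimum_exists)
      then show "j \<in> (\<Union>m\<in>cycle_minima n \<pi>. orbit \<pi> m)"
        using permutation_self_in_orbit[OF perm, of j] by auto
    qed
  qed
  then show "set (Psi n \<pi>) = {1..n}" using facts(1) unfolding Psi ms(1) by blast
qed

text \<open>Reading off the letter is a bijection from positions to \<open>{1..n}\<close>, and the
  next letter is in the same cycle exactly when the image is no cycle minimum. \<open>R\<close> is
  left open to serve ascents and descents alike.\<close>

lemma card_Psi_positions: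
  assumes "\<pi> permutes {1..n}"
  shows "card {i. i + 1 < length (Psi n \<pi>) \<and> Psi n \<pi> ! (i + 1) \<in> orbit \<pi> (Psi n \<pi> ! i)
      \<and> R (Psi n \<pi> ! i) (Psi n \<pi> ! (i + 1))}
    = card {j \<in> {1..n}. \<pi> j \<notin> cycle_minima n \<pi> \<and> R j (\<pi> j)}" (is "card ?I = card ?J")
proof (rule bij_betw_same_card)
  note facts = Psi_facts[OF assms]
  have I: "?I = {i. i < length (Psi n \<pi>) \<and> \<pi> (Psi n \<pi> ! i) \<notin> cycle_minima n \<pi>
      \<and> R (Psi n \<pi> ! i) (\<pi> (Psi n \<pi> ! i))}"
    using facts(3,4) by (metis (no_types, lifting) Suc_eq_plus1 Suc_lessD)
  show "bij_betw ((!) (Psi n \<pi>)) ?I ?J"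
    unfolding I
  proof (rule bij_betw_subset[OF bij_betw_nth[OF facts(2) refl refl]])
    show "(!) (Psi n \<pi>) ` {i. i < length (Psi n \<pi>) \<and> \<pi> (Psi n \<pi> ! i) \<notin> cycle_minima n \<pi>
        \<and> R (Psi n \<pi> ! i) (\<pi> (Psi n \<pi> ! i))} = ?J"
      unfolding facts(1)[symmetric] by (force simp: in_set_conv_nth)
  qed auto
qed

lemma asc_eq_card_excedances:
  assumes "\<pi> permutes {1..n}"
  shows "asc n \<pi> = card {j \<in> {1..n}. j < \<pi> j}"
proof -
  have "{j \<in> {1..n}. j < \<pi> j} = {j \<in> {1..n}. \<pi> j \<notin> cycle_minima n \<pi> \<and> j < \<pi> j}"
    using cycle_minimum_le[OF permutation_of_permutes[OF assms]] by force
  then show ?thesis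
    using card_Psi_positions[OF assms, of "(<)"] by (simp add: asc_def cyclic_ascents_def)
qed

text \<open>Since \<open>\<pi>\<close> is a bijection, as many elements are sent to cycle minima as
  there are cycles. The identity later yields \<open>des\<close> from \<open>asc\<close> and
  \<open>cyc\<close>, so only these two are tracked.\<close>

lemma des_asc_cyc:
  assumes "\<pi> permutes {1..n}"
  shows "des n \<pi> + asc n \<pi> + cyc n \<pi> = n"
proof -
  have perm: "permutation \<pi>" using assms by (rule permutation_of_permutes)
  let ?A = "{j \<in> {1..n}. \<pi> j \<notin> cycle_minima n \<pi> \<and> j < \<pi> j}"
  let ?B = "{j \<in> {1..n}. \<pi> j \<notin> cycle_minima n \<pi> \<and> j > \<pi> j}"
  let ?C = "{j \<in> {1..n}. \<pi> j \<in> cycle_minima n \<pi>}"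
  \<comment> \<open>A fixed point is the minimum of its cycle, so the case
    \<open>\<pi> j = j\<close> falls under \<open>?C\<close>.\<close>
  have "j \<in> cycle_minima n \<pi>" if "j \<in> {1..n}" "\<pi> j = j" for j
  proof -
    have "orbit \<pi> j = {j}" using that(2) by (simp add: orbit_eq_singleton_iff)
    then show ?thesis using that(1) by (simp add: cycle_minima_def)
  qed
  then have "{1..n} = ?A \<union> ?B \<union> ?C" by (auto simp: neq_iff[symmetric]) (metis nat_neq_iff)
  then have "n = card (?A \<union> ?B \<union> ?C)" by (metis card_atLeastAtMost diff_Suc_1)
  also have "\<dots> = card ?A + card ?B + card ?C"
    by (subst card_Un_disjoint; (subst card_Un_disjoint)?) auto
  also have "card ?A = asc n \<pi>"
    using card_Psi_positions[OF assms, of "(<)"] by (simp add: asc_def cyclic_ascents_def)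
  also have "card ?B = des n \<pi>"
    using card_Psi_positions[OF assms, of "(>)"] by (simp add: des_def cyclic_descents_def)
  also have "card ?C = cyc n \<pi>"
  proof -
    have "bij_betw \<pi> ?C (cycle_minima n \<pi>)"
    proof (rule bij_betw_subset[OF permutes_imp_bij[OF assms]])
      show "\<pi> ` ?C = cycle_minima n \<pi>"
      proof
        show "cycle_minima n \<pi> \<subseteq> \<pi> ` ?C"
        proof
          fix m assume m: "m \<in> cycle_minima n \<pi>"
          then have "m \<in> \<pi> ` {1..n}"
            unfolding permutes_image[OF assms] by (simp add: cycle_minima_def)
          with m show "m \<in> \<pi> ` ?C" by blast
        qed
      qed auto
    qed auto
    then show ?thesis using cyc_eq_card_cycle_minima[OF assms] bij_betw_same_card by metis
  qed
  finally show ?thesis by simp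
qed

subsection \<open>Inserting the largest element\<close>

lemma permutes_Suc: "\<pi> permutes {1..n} \<Longrightarrow> \<pi> permutes {1..Suc n}"
  by (rule permutes_subset) auto

lemma asc_cyc_des_fixed_point_Suc:
  assumes "\<pi> permutes {1..n}"
  shows "asc (Suc n) \<pi> = asc n \<pi>" and "cyc (Suc n) \<pi> = Suc (cyc n \<pi>)"
    and "des (Suc n) \<pi> = des n \<pi>"
proof -
  note permS = permutes_Suc[OF assms]
  have fix_Suc: "\<pi> (Suc n) = Suc n" using assms by (simp add: permutes_not_in)
  have "{j \<in> {1..Suc n}. j < \<pi> j} = {j \<in> {1..n}. j < \<pi> j}"
    using fix_Suc by (auto simp: le_Suc_eq)
  then show asc: "asc (Suc n) \<pi> = asc n \<pi>"
    by (simp only: asc_eq_card_excedances[OF assms] asc_eq_card_excedances[OF permS])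
  have "orbit \<pi> (Suc n) = {Suc n}" using fix_Suc by (simp add: orbit_eq_singleton_iff)
  then have "m \<in> cycle_minima (Suc n) \<pi> \<longleftrightarrow> m \<in> insert (Suc n) (cycle_minima n \<pi>)" for m
    by (cases "m = Suc n") (simp_all add: cycle_minima_def le_Suc_eq, linarith)
  then have "cycle_minima (Suc n) \<pi> = insert (Suc n) (cycle_minima n \<pi>)" by blast
  moreover have "Suc n \<notin> cycle_minima n \<pi>" by (simp add: cycle_minima_def)
  ultimately show cyc: "cyc (Suc n) \<pi> = Suc (cyc n \<pi>)"
    by (simp add: cyc_eq_card_cycle_minima[OF assms] cyc_eq_card_cycle_minima[OF permS]
        finite_cycle_minima)
  show "des (Suc n) \<pi> = des n \<pi>"
    using des_asc_cyc[OF assms] des_asc_cyc[OF permS] asc cyc by simp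
qed

text \<open>\<open>\<rho>\<close> inserts \<open>Suc n\<close> between \<open>j\<close> and
  \<open>\<pi> j\<close>. Being the largest element, \<open>Suc n\<close> is neither a cycle minimum
  nor an excedance, whereas \<open>j\<close> is now an excedance in any case.\<close>

lemma asc_cyc_insert_Suc:
  assumes "\<pi> permutes {1..n}" and j: "j \<in> {1..n}"
  defines "\<rho> \<equiv> transpose (Suc n) (\<pi> j) \<circ> \<pi>"
  shows "\<rho> permutes {1..Suc n}" and "cyc (Suc n) \<rho> = cyc n \<pi>"
    and "asc (Suc n) \<rho> = (if j < \<pi> j then asc n \<pi> else Suc (asc n \<pi>))"
proof -
  have fix_Suc: "\<pi> (Suc n) = Suc n" using assms(1) by (simp add: permutes_not_in)
  have in_n: "\<pi> i \<in> {1..n} \<longleftrightarrow> i \<in> {1..n}" for i using assms(1) by (rule permutes_in_image)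
  have inj: "\<pi> i = \<pi> k \<longleftrightarrow> i = k" for i k
    using permutes_inj[OF assms(1)] by (simp add: inj_eq)
  have \<pi>j: "\<pi> j \<in> {1..n}" using in_n j by simp
  show perm: "\<rho> permutes {1..Suc n}"
    unfolding \<rho>_def
    by (rule permutes_compose[OF permutes_Suc[OF assms(1)]], rule permutes_swap_id)
      (use \<pi>j in auto)
  have \<rho>_j: "\<rho> j = Suc n" by (simp add: \<rho>_def)
  have \<rho>_Suc: "\<rho> (Suc n) = \<pi> j" by (simp add: \<rho>_def fix_Suc)
  have \<rho>_else: "\<rho> i = \<pi> i" if "i \<in> {1..n}" "i \<noteq> j" for i
  proof -
    have "\<pi> i \<noteq> \<pi> j" and "\<pi> i \<noteq> Suc n" using that in_n[of i] inj by auto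
    then show ?thesis by (simp add: \<rho>_def)
  qed

  \<comment> \<open>Together with \<open>orbit_le\<close>: an old orbit gains at most
    \<open>Suc n\<close>, which cannot affect its minimum.\<close>
  have orbit_ge: "orbit \<pi> m \<subseteq> orbit \<rho> m" if m: "m \<in> {1..n}" for m
  proof
    have step: "\<pi> i \<in> orbit \<rho> m" if "i \<in> {1..n}" "i = m \<or> i \<in> orbit \<rho> m" for i
      using that \<rho>_else \<rho>_j \<rho>_Suc by (metis orbit.base orbit.step)
    fix y assume "y \<in> orbit \<pi> m"
    then have "y \<in> {1..n} \<and> y \<in> orbit \<rho> m"
      by induction (use m step in_n in blast)+
    then show "y \<in> orbit \<rho> m" by simp
  qed
  have orbit_le: "orbit \<rho> m \<subseteq> insert (Suc n) (orbit \<pi> m)" if m: "m \<in> {1..n}" for m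
  proof
    fix y assume "y \<in> orbit \<rho> m"
    \<comment> \<open>The first alternative remembers that \<open>\<pi> j\<close> is in the old
      orbit, because \<open>\<rho>\<close> moves from \<open>Suc n\<close> to
      \<open>\<pi> j\<close>.\<close>
    then have "y = Suc n \<and> \<pi> j \<in> orbit \<pi> m \<or> y \<in> {1..n} \<and> y \<in> orbit \<pi> m"
    proof induction
      case base
      then show ?case using m in_n \<rho>_else \<rho>_j by (cases "m = j") (auto intro: orbit.base)
    next
      case (step y)
      then consider (new) "y = Suc n" "\<pi> j \<in> orbit \<pi> m" | (old) "y \<in> {1..n}" "y \<in> orbit \<pi> m"
        by blast
      then show ?case
      proof cases
        case new
        then show ?thesis using \<pi>j by (simp add: \<rho>_Suc)
      next
        case old
        then have "\<pi> y \<in> orbit \<pi> m" by (blast intro: orbit.step)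
        then show ?thesis using old in_n[of y] \<rho>_else[of y] \<rho>_j by (cases "y = j") simp_all
      qed
    qed
    then show "y \<in> insert (Suc n) (orbit \<pi> m)" by auto
  qed
  have "\<not> Suc n \<le> \<pi> j" "\<pi> j \<in> orbit \<rho> (Suc n)"
    using \<pi>j orbit.base[of \<rho> "Suc n"] by (auto simp: \<rho>_Suc)
  then have "Suc n \<notin> cycle_minima (Suc n) \<rho>" by (auto simp: cycle_minima_def)
  moreover have "m \<in> cycle_minima (Suc n) \<rho> \<longleftrightarrow> m \<in> cycle_minima n \<pi>" if "m \<in> {1..n}" for m
  proof -
    have "(\<forall>y\<in>orbit \<rho> m. m \<le> y) \<longleftrightarrow> (\<forall>y\<in>orbit \<pi> m. m \<le> y)"
      using orbit_ge[OF that] orbit_le[OF that] that by force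
    then show ?thesis using that by (simp add: cycle_minima_def)
  qed
  moreover have "cycle_minima (Suc n) \<rho> \<subseteq> {1..Suc n}" "cycle_minima n \<pi> \<subseteq> {1..n}"
    by (auto simp: cycle_minima_def)
  ultimately have "cycle_minima (Suc n) \<rho> = cycle_minima n \<pi>"
    by (auto simp: le_Suc_eq subset_iff)
  then show "cyc (Suc n) \<rho> = cyc n \<pi>"
    by (simp add: cyc_eq_card_cycle_minima[OF assms(1)] cyc_eq_card_cycle_minima[OF perm])

  have "i < \<rho> i \<longleftrightarrow> i = j \<or> i < \<pi> i" if "i \<in> {1..n}" for i
    using that \<rho>_else \<rho>_j by (cases "i = j") auto
  moreover have "\<not> Suc n < \<rho> (Suc n)" using \<pi>j by (simp add: \<rho>_Suc)
  ultimately have "{i \<in> {1..Suc n}. i < \<rho> i} = insert j {i \<in> {1..n}. i < \<pi> i}"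
    using j by (auto simp: le_Suc_eq)
  then show "asc (Suc n) \<rho> = (if j < \<pi> j then asc n \<pi> else Suc (asc n \<pi>))"
    using j by (simp add: asc_eq_card_excedances[OF assms(1)] asc_eq_card_excedances[OF perm]
        card_insert_if)
qed

section \<open>Weight sums and their recurrence\<close>

definition perm_weight :: "'a::comm_ring_1 \<Rightarrow> 'a \<Rightarrow> 'a \<Rightarrow> nat \<Rightarrow> (nat \<Rightarrow> nat) \<Rightarrow> 'a"
  where "perm_weight p q x n \<pi> = p ^ des n \<pi> * q ^ asc n \<pi> * x ^ cyc n \<pi>"

definition perm_poly :: "'a::comm_ring_1 \<Rightarrow> 'a \<Rightarrow> 'a \<Rightarrow> nat \<Rightarrow> 'a"
  where "perm_poly p q x n = (\<Sum>\<pi> | \<pi> permutes {1..n}. perm_weight p q x n \<pi>)"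

text \<open>The three statistics add up to one more than before and \<open>cyc\<close> is unchanged.
  If \<open>j\<close> was already an excedance, \<open>des\<close> takes the increase, otherwise
  \<open>asc\<close> does.\<close>

lemma perm_weight_insert_Suc:
  assumes "\<pi> permutes {1..n}" and "j \<in> {1..n}"
  shows "perm_weight p q x (Suc n) (transpose (Suc n) (\<pi> j) \<circ> \<pi>)
    = perm_weight p q x n \<pi> * (if j < \<pi> j then p else q)"
proof -
  let ?\<rho> = "transpose (Suc n) (\<pi> j) \<circ> \<pi>"
  note ins = asc_cyc_insert_Suc[OF assms]
  have "des (Suc n) ?\<rho> = (if j < \<pi> j then Suc (des n \<pi>) else des n \<pi>)"
    using des_asc_cyc[OF assms(1)] des_asc_cyc[OF ins(1)] ins(2,3) by (simp split: if_splits)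
  then show ?thesis unfolding perm_weight_def ins(2,3) by (simp add: mult_ac)
qed

text \<open>Each permutation of \<open>{1..Suc n}\<close> is
  \<open>transpose (Suc n) b \<circ> \<pi>\<close> for one pair \<open>b\<close>,
  \<open>\<pi>\<close>. Here \<open>b = Suc n\<close> is a new fixed point, and
  \<open>b = \<pi> j\<close> is insertion after \<open>j\<close>, with factor \<open>p\<close> for
  the \<open>asc n \<pi>\<close> excedances and \<open>q\<close> for the rest.\<close>

lemma perm_poly_Suc:
  "perm_poly p q x (Suc n) = (\<Sum>\<pi> | \<pi> permutes {1..n}. perm_weight p q x n \<pi>
    * (x + of_nat (asc n \<pi>) * p + (of_nat n - of_nat (asc n \<pi>)) * q))"
proof -
  have "(\<Sum>b\<in>insert (Suc n) {1..n}. perm_weight p q x (Suc n) (transpose (Suc n) b \<circ> \<pi>))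
      = perm_weight p q x n \<pi> * (x + of_nat (asc n \<pi>) * p + (of_nat n - of_nat (asc n \<pi>)) * q)"
    if \<pi>: "\<pi> permutes {1..n}" for \<pi>
  proof -
    let ?w = "perm_weight p q x n \<pi>"
    let ?A = "{j \<in> {1..n}. j < \<pi> j}"
    have "(\<Sum>b\<in>{1..n}. perm_weight p q x (Suc n) (transpose (Suc n) b \<circ> \<pi>))
        = (\<Sum>j\<in>{1..n}. perm_weight p q x (Suc n) (transpose (Suc n) (\<pi> j) \<circ> \<pi>))"
      by (rule sum.reindex_bij_betw[OF permutes_imp_bij[OF \<pi>], symmetric])
    also have "\<dots> = (\<Sum>j\<in>{1..n}. ?w * (if j < \<pi> j then p else q))"
      by (intro sum.cong refl perm_weight_insert_Suc[OF \<pi>])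
    also have "\<dots> = ?w * ((\<Sum>j\<in>?A. p) + (\<Sum>j\<in>{1..n} - ?A. q))"
    proof -
      have "{j \<in> {1..n}. \<not> j < \<pi> j} = {1..n} - ?A" by auto
      then show ?thesis
        by (simp only: sum_distrib_left[symmetric] sum.If_cases finite_atLeastAtMost
            Int_def mem_Collect_eq Collect_neg_eq[symmetric])
    qed
    also have "(\<Sum>j\<in>{1..n} - ?A. q) = (of_nat n - of_nat (asc n \<pi>)) * q"
    proof -
      have "card ({1..n} - ?A) = n - card ?A" by (subst card_Diff_subset) auto
      moreover have "card ?A \<le> n" using card_mono[of "{1..n}" ?A] by fastforce
      ultimately show ?thesis by (simp add: asc_eq_card_excedances[OF \<pi>] of_nat_diff)
    qed
    also have "(\<Sum>j\<in>?A. p) = of_nat (asc n \<pi>) * p"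
      by (simp add: asc_eq_card_excedances[OF \<pi>])
    finally have "(\<Sum>b\<in>{1..n}. perm_weight p q x (Suc n) (transpose (Suc n) b \<circ> \<pi>))
        = ?w * (of_nat (asc n \<pi>) * p + (of_nat n - of_nat (asc n \<pi>)) * q)" .
    moreover have "perm_weight p q x (Suc n) \<pi> = ?w * x"
      by (simp add: perm_weight_def asc_cyc_des_fixed_point_Suc[OF \<pi>] mult_ac)
    ultimately show ?thesis by (simp add: algebra_simps)
  qed
  moreover have "{1..Suc n} = insert (Suc n) {1..n}" by auto
  moreover have "perm_poly p q x (Suc n) = (\<Sum>b\<in>insert (Suc n) {1..n}.
      \<Sum>\<pi> | \<pi> permutes {1..n}. perm_weight p q x (Suc n) (transpose (Suc n) b \<circ> \<pi>))"
    unfolding perm_poly_def \<open>{1..Suc n} = insert (Suc n) {1..n}\<close>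
    by (rule sum_over_permutations_insert) auto
  ultimately show ?thesis
    by (subst (asm) sum.swap) simp
qed

lemma perm_poly_0: "perm_poly p q x 0 = 1"
proof -
  have "{\<pi>. \<pi> permutes {1..0::nat}} = {id}" by (auto simp: permutes_empty)
  moreover have "des 0 id + asc 0 id + cyc 0 id = 0" by (rule des_asc_cyc) (rule permutes_id)
  ultimately show ?thesis by (simp add: perm_poly_def perm_weight_def)
qed

text \<open>The constant coefficient is a ring homomorphism. This and
  \<open>fps_nth_0_motzkin\<close> bring the final identity back to the coefficient ring.\<close>

lemma fps_nth_0_perm_poly:
  "fps_nth (perm_poly P Q Y n) 0 = perm_poly (fps_nth P 0) (fps_nth Q 0) (fps_nth Y 0) n"
  by (simp add: perm_poly_def perm_weight_def fps_sum_nth fps_nth_power_0)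

subsection \<open>Motzkin paths and continued fractions\<close>

text \<open>The recursion removes the last step of a path; up steps weigh \<open>1\<close>, and
  \<open>l\<close> is indexed by the height where a down step starts.\<close>

primrec motzkin :: "(nat \<Rightarrow> 'a::comm_ring_1) \<Rightarrow> (nat \<Rightarrow> 'a) \<Rightarrow> nat \<Rightarrow> nat \<Rightarrow> 'a"
  where
    "motzkin b l 0 k = (if k = 0 then 1 else 0)"
  | "motzkin b l (Suc n) k = (case k of 0 \<Rightarrow> 0 | Suc j \<Rightarrow> motzkin b l n j)
      + b k * motzkin b l n k + l (Suc k) * motzkin b l n (Suc k)"

lemma motzkin_eq_0: "n < k \<Longrightarrow> motzkin b l n k = 0"
  by (induction n arbitrary: k) (auto split: nat.split)

lemma fps_nth_0_motzkin:
  "fps_nth (motzkin b l n k) 0 = motzkin (\<lambda>k. fps_nth (b k) 0) (\<lambda>k. fps_nth (l k) 0) n k"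
  by (induction n arbitrary: k) (auto split: nat.split)

lemma cfrac_tail_Suc_mult:
  assumes "\<And>h. fps_nth (D h) 0 = 1" and "\<And>h. fps_nth (A h) 0 = 0"
  shows "(D h - A h * cfrac_tail D A N (Suc h)) * cfrac_tail D A (Suc N) h = 1"
  using mult_fps_recip[of "D h - A h * cfrac_tail D A N (Suc h)"] assms by simp

text \<open>Removing the last step of a path relates the series \<open>F k\<close> of neighbouring
  heights; solved for \<open>F k / G k\<close>, this relation is one level of the continued
  fraction.\<close>

lemma has_cfrac_motzkin:
  fixes b l :: "nat \<Rightarrow> 'a::comm_ring_1"
  shows "has_cfrac (Abs_fps (\<lambda>n. motzkin b l n 0))
    (\<lambda>h. 1 - fps_const (b h) * fps_X) (\<lambda>h. fps_const (l (Suc h)) * fps_X ^ 2)"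
proof -
  define D where "D h = 1 - fps_const (b h) * fps_X" for h
  define A where "A h = fps_const (l (Suc h)) * fps_X ^ 2" for h
  define F where "F k = Abs_fps (\<lambda>n. motzkin b l n k)" for k
  \<comment> \<open>\<open>G k\<close> collects the empty path if \<open>k = 0\<close> and the paths
    ending in an up step otherwise.\<close>
  define G where "G k = (case k of 0 \<Rightarrow> 1 | Suc j \<Rightarrow> fps_X * F j)" for k
  have F_rec: "D k * F k = G k + fps_const (l (Suc k)) * fps_X * F (Suc k)" for k
  proof (rule fps_ext)
    fix n
    show "fps_nth (D k * F k) n = fps_nth (G k + fps_const (l (Suc k)) * fps_X * F (Suc k)) n"
      by (cases n) (auto simp: D_def F_def G_def algebra_simps split: nat.split)
  qed
  have cf: "(D h - A h * cfrac_tail D A N (Suc h)) * cfrac_tail D A (Suc N) h = 1" for h N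
    by (rule cfrac_tail_Suc_mult) (simp_all add: D_def A_def)
  \<comment> \<open>Finite form of \<open>F k = G k * T\<close> with \<open>T\<close> the infinite
    tail from level \<open>k\<close>. Reaching height \<open>k\<close> takes \<open>k\<close> steps,
    and each level improves the order by at least one.\<close>
  have approx: "fps_X ^ (k + N) dvd F k - G k * cfrac_tail D A N k" for N k
  proof (induction N arbitrary: k)
    case 0
    have "F k = fps_X ^ k * fps_shift k (F k)"
      by (rule fps_ext) (simp add: F_def fps_X_power_mult_nth motzkin_eq_0)
    then show ?case by (metis add_0_right cfrac_tail.simps(1) diff_zero dvd_triv_left mult_zero_right)
  next
    case (Suc N)
    let ?C = "cfrac_tail D A N (Suc k)" and ?C' = "cfrac_tail D A (Suc N) k"
    define E where "E = D k - A k * ?C"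
    obtain R where R: "F (Suc k) - G (Suc k) * ?C = fps_X ^ (Suc k + N) * R"
      using Suc.IH[of "Suc k"] by (auto elim: dvdE)
    \<comment> \<open>Besides \<open>F_rec\<close>, this uses that \<open>A k * F k\<close> is
      \<open>fps_const (l (Suc k)) * fps_X * G (Suc k)\<close>.\<close>
    have "(D k - A k * ?C) * F k - G k
        = fps_const (l (Suc k)) * fps_X * (F (Suc k) - G (Suc k) * ?C)"
      by (simp add: left_diff_distrib F_rec) (simp add: A_def G_def algebra_simps power2_eq_square)
    also have "\<dots> = fps_X ^ (k + Suc N) * (fps_const (l (Suc k)) * fps_X * R)"
      unfolding R by (simp add: mult_ac)
    finally have eq: "E * F k - G k = fps_X ^ (k + Suc N) * (fps_const (l (Suc k)) * fps_X * R)"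
      by (simp only: E_def)
    have "F k - G k * ?C' = (E * ?C') * F k - G k * ?C'" unfolding E_def cf by simp
    also have "\<dots> = (E * F k - G k) * ?C'" by (simp add: algebra_simps)
    finally show ?case unfolding eq by (simp only: mult.assoc dvd_triv_left)
  qed
  have "(\<lambda>N. cfrac_tail D A N 0) \<longlonglongrightarrow> F 0"
  proof (rule tendsto_fpsI)
    fix n
    show "\<forall>\<^sub>F N in sequentially. fps_nth (cfrac_tail D A N 0) n = fps_nth (F 0) n"
    proof (rule eventually_sequentiallyI[of "Suc n"])
      fix N assume "Suc n \<le> N"
      moreover obtain R where "F 0 - cfrac_tail D A N 0 = fps_X ^ N * R"
        using approx[of 0 N] by (auto simp: G_def elim: dvdE)
      ultimately have "fps_nth (F 0 - cfrac_tail D A N 0) n = 0"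
        by (simp add: fps_X_power_mult_nth)
      then show "fps_nth (cfrac_tail D A N 0) n = fps_nth (F 0) n" by simp
    qed
  qed
  then show ?thesis by (simp add: has_cfrac_def D_def[abs_def] A_def[abs_def] F_def)
qed

subsection \<open>The derivation\<close>

text \<open>\<open>D\<close> stands for \<open>q \<partial>\<^sub>q\<close>, expressed by the
  hypotheses \<open>D p = 0\<close>, \<open>D q = q\<close>, \<open>D x = 0\<close> on ring elements
  below.\<close>

locale ring_derivation =
  fixes D :: "'a::comm_ring_1 \<Rightarrow> 'a"
  assumes D_add: "D (f + g) = D f + D g"
    and D_mult: "D (f * g) = D f * g + f * D g"
begin

lemma D_0: "D 0 = 0"
  using D_add[of 0 0] by simp

lemma D_1: "D 1 = 0"
  using D_mult[of 1 1] by simp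

lemma D_of_nat: "D (of_nat m) = 0"
  by (induction m) (simp_all add: D_0 D_1 D_add)

lemma D_sum: "D (sum f A) = (\<Sum>i\<in>A. D (f i))"
  by (induction A rule: infinite_finite_induct) (simp_all add: D_0 D_add)

lemma D_power_const: "D c = 0 \<Longrightarrow> D (c ^ n) = 0"
  by (induction n) (simp_all add: D_1 D_mult)

lemma D_power_eigen: "D q = q \<Longrightarrow> D (q ^ n) = of_nat n * q ^ n"
  by (induction n) (simp_all add: D_1 D_mult algebra_simps)

text \<open>A path to height \<open>k\<close> has \<open>k\<close> more up than down steps,
  \<open>b\<close> is linear and \<open>l\<close> quadratic, so \<open>motzkin b l n k\<close> has
  degree \<open>n - k\<close>. Writing \<open>E\<close> as \<open>(n - k) q + (p - q) D\<close>
  turns \<open>E (M n k) = l (k + 1) M n (k + 1)\<close> into this identity.\<close>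

lemma motzkin_derivation:
  assumes "D p = 0" and "D q = q" and "D x = 0"
  defines "b \<equiv> \<lambda>k. of_nat k * q + of_nat k * p + x"
    and "l \<equiv> \<lambda>k. of_nat k * q * (of_nat (k - 1) * p + x)"
  shows "(p - q) * D (motzkin b l n k)
    = l (Suc k) * motzkin b l n (Suc k) + (of_nat k - of_nat n) * q * motzkin b l n k"
proof -
  have D_b: "D (b k) = of_nat k * q" for k
    by (simp add: b_def D_add D_mult D_of_nat assms(1-3))
  have D_l: "D (l k) = l k" for k
    by (simp add: l_def D_add D_mult D_of_nat assms(1-3))
  \<comment> \<open>The truncated \<open>k - 1\<close> at \<open>k = 0\<close> is harmless, as the
    factor \<open>of_nat k\<close> vanishes.\<close>
  have l_0: "l 0 = 0" by (simp add: l_def)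
  \<comment> \<open>The first Toda equation:
    \<open>E (b k) = q b k + (p - q) k q = (2 k p + x) q\<close>.\<close>
  have l_diff: "l (Suc k) = l k + (2 * of_nat k * p + x) * q" for k
    by (cases k) (simp_all add: l_def algebra_simps)
  show ?thesis
  proof (induction n arbitrary: k)
    case 0
    show ?case by (simp add: D_0 D_1)
  next
    case (Suc n)
    let ?M = "motzkin b l n"
    define up where "up = (case k of 0 \<Rightarrow> 0 | Suc j \<Rightarrow> ?M j)"
    \<comment> \<open>The induction hypothesis at \<open>k - 1\<close>; for \<open>k = 0\<close>
      both sides vanish because \<open>l 0 = 0\<close>.\<close>
    have up: "(p - q) * D up = l k * ?M k + (of_nat k - 1 - of_nat n) * q * up"
      using Suc.IH by (cases k) (simp_all add: up_def D_0 l_0)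
    \<comment> \<open>With \<open>D_l\<close> this is the second Toda equation, as
      \<open>E (l k) = (2 q + p - q) l k\<close>.\<close>
    have b_Suc: "b (Suc k) = b k + q + p" by (simp add: b_def algebra_simps)
    have "(p - q) * D (motzkin b l (Suc n) k)
        = (p - q) * D up + (p - q) * of_nat k * q * ?M k + b k * ((p - q) * D (?M k))
          + l (Suc k) * ((p - q) * ?M (Suc k) + (p - q) * D (?M (Suc k)))"
      by (simp add: up_def[symmetric] D_add D_mult D_b D_l algebra_simps)
    also have "\<dots> = l (Suc k) * motzkin b l (Suc n) (Suc k)
        + (of_nat k - of_nat (Suc n)) * q * motzkin b l (Suc n) k"
      unfolding up Suc.IH
      by (simp add: up_def[symmetric] b_Suc) (simp add: l_diff[of k] b_def algebra_simps)
    finally show ?case .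
  qed
qed

text \<open>\<open>D\<close> multiplies each weight by \<open>asc n \<pi>\<close>, the exponent of
  \<open>q\<close>, and the factor in \<open>perm_poly_Suc\<close> is
  \<open>x + n q + (p - q) asc n \<pi>\<close>.\<close>

lemma perm_poly_Suc_derivation:
  assumes "D p = 0" and "D q = q" and "D x = 0"
  shows "perm_poly p q x (Suc n)
    = (x + of_nat n * q) * perm_poly p q x n + (p - q) * D (perm_poly p q x n)"
proof -
  have "D (perm_weight p q x n \<pi>) = of_nat (asc n \<pi>) * perm_weight p q x n \<pi>" for \<pi>
    by (simp add: perm_weight_def D_mult D_power_const D_power_eigen assms mult_ac)
  then show ?thesis
    unfolding perm_poly_Suc unfolding perm_poly_def
    by (simp add: D_sum sum_distrib_left sum.distrib[symmetric])
      (intro sum.cong refl, simp add: algebra_simps)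
qed

text \<open>At height \<open>0\<close> the terms \<open>n q\<close> cancel, leaving
  \<open>x M n 0 + l 1 M n 1\<close>, which is the path recursion since
  \<open>b 0 = x\<close>.\<close>

lemma perm_poly_eq_motzkin_of_derivation:
  assumes "D p = 0" and "D q = q" and "D x = 0"
  shows "perm_poly p q x n = motzkin (\<lambda>k. of_nat k * q + of_nat k * p + x)
    (\<lambda>k. of_nat k * q * (of_nat (k - 1) * p + x)) n 0"
proof (induction n)
  case (Suc n)
  show ?case
    unfolding perm_poly_Suc_derivation[OF assms] Suc.IH motzkin_derivation[OF assms]
    by (simp add: algebra_simps)
qed (simp add: perm_poly_0)

end

text \<open>
  Over the power series, \<open>D f = (1 + X) f'\<close> is a derivation with \<open>D (q (1 + X)) = q (1 + X)\<close> that
  kills constants; the constant coefficient then specialises \<open>q (1 + X)\<close> to \<open>q\<close>.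
\<close>

lemma perm_poly_eq_motzkin:
  "perm_poly p q x n = motzkin (\<lambda>k. of_nat k * q + of_nat k * p + x)
    (\<lambda>k. of_nat k * q * (of_nat (k - 1) * p + x)) n 0"
proof -
  define D where "D f = (1 + fps_X) * fps_deriv f" for f :: "'a fps"
  interpret ring_derivation D
    by unfold_locales (simp_all add: D_def algebra_simps)
  let ?P = "fps_const p" and ?Q = "fps_const q * (1 + fps_X)" and ?X = "fps_const x"
  have "D ?P = 0" and "D ?Q = ?Q" and "D ?X = 0"
    by (simp_all add: D_def mult_ac)
  then have "fps_nth (perm_poly ?P ?Q ?X n) 0
      = fps_nth (motzkin (\<lambda>k. of_nat k * ?Q + of_nat k * ?P + ?X)
          (\<lambda>k. of_nat k * ?Q * (of_nat (k - 1) * ?P + ?X)) n 0) 0"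
    by (simp only: perm_poly_eq_motzkin_of_derivation)
  then show ?thesis
    by (simp add: fps_nth_0_perm_poly fps_nth_0_motzkin)
qed

theorem mainTheorem2:
  fixes p q x :: "'a::comm_ring_1"
  shows "has_cfrac
    (Abs_fps (\<lambda>n. \<Sum>\<pi> | \<pi> permutes {1..n}. p ^ des n \<pi> * q ^ asc n \<pi> * x ^ cyc n \<pi>))
    (\<lambda>h. 1 - fps_const (of_nat h * q + of_nat h * p + x) * fps_X)
    (\<lambda>h. fps_const (of_nat (h + 1) * q * (of_nat h * p + x)) * fps_X ^ 2)"
  \<comment> \<open>Level \<open>h\<close> uses \<open>l (Suc h)\<close>, where \<open>k - 1\<close>
    becomes \<open>h\<close>.\<close>
  using has_cfrac_motzkin[of "\<lambda>k. of_nat k * q + of_nat k * p + x"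
      "\<lambda>k. of_nat k * q * (of_nat (k - 1) * p + x)"]
  unfolding perm_poly_eq_motzkin[symmetric] by (simp add: perm_poly_def perm_weight_def)

end
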